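(* Let $\mathcal{C}$ be a category with binary products, let $\Sigma\colon\mathcal{C}\to\mathcal{C}$ be an endofunctor with an initial algebra $(\mu\Sigma,\iota)$ and free algebras $\Sigma^{\star}X$ on every object $X$, and let $B\colon\mathcal{C}\to\mathcal{C}$ be an endofunctor with a final coalgebra $(\nu B,\tau)$. Let $\rho$ be a pre-GSOS law of $\Sigma$ over $B$ that is natural with respect to the morphisms $\hat\iota\colon\Sigma^{\star}(\mu\Sigma)\to\mu\Sigma$ and $\Sigma^{\star}\mathsf{beh}\colon\Sigma^{\star}(\mu\Sigma)\to\Sigma^{\star}(\nu B)$. Then the behaviour morphism $\mathsf{beh}\colon\mu\Sigma\to\nu B$ is a morphic congruence on the initial algebra $(\mu\Sigma,\iota)$.
   Context: Free algebras: $(\Sigma^{\star}X,\iota_X)$ with universal map $\eta_X\colon X\to\Sigma^{\star}X$; they form the free monad $\Sigma^{\star}$ (multiplication $\mu$). $\hat\iota\colon\Sigma^{\star}(\mu\Sigma)\to\mu\Sigma$ is the unique $\Sigma$-algebra morphism $(\Sigma^{\star}(\mu\Sigma),\iota_{\mu\Sigma})\to(\mu\Sigma,\iota)$ with $\hat\iota\circ\eta_{\mu\Sigma}=\mathrm{id}$. A pre-GSOS law of $\Sigma$ over $B$ is a family of morphisms $\rho_X\colon\Sigma(X\times BX)\to B\Sigma^{\star}X$ ($X\in\mathcal{C}$), not required to be natural; it is natural with respect to $f\colon X\to Y$ if $\rho_Y\circ\Sigma(f\times Bf)=B\Sigma^{\star}f\circ\rho_X$. The operational model of $\rho$ is the unique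 $\gamma\colon\mu\Sigma\to B(\mu\Sigma)$ with $\gamma\circ\iota=B\hat\iota\circ\rho_{\mu\Sigma}\circ\Sigma\langle\mathrm{id},\gamma\rangle$, and $\mathsf{beh}\colon(\mu\Sigma,\gamma)\to(\nu B,\tau)$ is the unique $B$-coalgebra morphism into the final coalgebra. A morphism $h\colon A\to A'$ is a morphic congruence on a $\Sigma$-algebra $(A,a)$ if there exists a $\Sigma$-algebra structure $a'\colon\Sigma A'\to A'$ with $h\circ a=a'\circ\Sigma h$. *)

theory Defs
  imports Main
begin

record ('o, 'm) category =
  Obj :: "'o set"
  Arr :: "'m set"
  Dom :: "'m \<Rightarrow> 'o"
  Cod :: "'m \<Rightarrow> 'o"
  Ident :: "'o \<Rightarrow> 'm"
  Comp :: "'m \<Rightarrow> 'm \<Rightarrow> 'm"  (infixr \<open>\<cdot>\<index>\<close> 70)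

definition hom :: "('o, 'm) category \<Rightarrow> 'o \<Rightarrow> 'o \<Rightarrow> 'm set" where
  "hom C X Y = {f \<in> Arr C. Dom C f = X \<and> Cod C f = Y}"

locale category =
  fixes C :: "('o, 'm) category" (structure)
  assumes Dom_in_Obj: "f \<in> Arr C \<Longrightarrow> Dom C f \<in> Obj C"
    and Cod_in_Obj: "f \<in> Arr C \<Longrightarrow> Cod C f \<in> Obj C"
    and Id_in_hom: "X \<in> Obj C \<Longrightarrow> Ident C X \<in> hom C X X"
    and Comp_in_hom: "f \<in> hom C X Y \<Longrightarrow> g \<in> hom C Y Z \<Longrightarrow> g \<cdot> f \<in> hom C X Z"
    and Comp_Id_right: "f \<in> hom C X Y \<Longrightarrow> f \<cdot> Ident C X = f"
    and Comp_Id_left: "f \<in> hom C X Y \<Longrightarrow> Ident C Y \<cdot> f = f"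
    and Comp_assoc: "f \<in> hom C W X \<Longrightarrow> g \<in> hom C X Y \<Longrightarrow> h \<in> hom C Y Z \<Longrightarrow>
      (h \<cdot> g) \<cdot> f = h \<cdot> (g \<cdot> f)"

text \<open>Binary products, and below the free algebras, are given by an arbitrary choice for all objects.\<close>

record ('o, 'm) binprod =
  prod_obj :: "'o \<Rightarrow> 'o \<Rightarrow> 'o"
  proj1 :: "'o \<Rightarrow> 'o \<Rightarrow> 'm"
  proj2 :: "'o \<Rightarrow> 'o \<Rightarrow> 'm"

definition binary_products :: "('o, 'm) category \<Rightarrow> ('o, 'm) binprod \<Rightarrow> bool" where
  "binary_products C P \<longleftrightarrow> (\<forall>X \<in> Obj C. \<forall>Y \<in> Obj C.
     prod_obj P X Y \<in> Obj C \<and>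
     proj1 P X Y \<in> hom C (prod_obj P X Y) X \<and>
     proj2 P X Y \<in> hom C (prod_obj P X Y) Y \<and>
     (\<forall>Z \<in> Obj C. \<forall>f \<in> hom C Z X. \<forall>g \<in> hom C Z Y.
        \<exists>!h. h \<in> hom C Z (prod_obj P X Y) \<and>
             proj1 P X Y \<cdot>\<^bsub>C\<^esub> h = f \<and> proj2 P X Y \<cdot>\<^bsub>C\<^esub> h = g))"

definition pairing :: "('o, 'm) category \<Rightarrow> ('o, 'm) binprod \<Rightarrow> 'm \<Rightarrow> 'm \<Rightarrow> 'm" where
  "pairing C P f g = (let X = Cod C f; Y = Cod C g in
     THE h. h \<in> hom C (Dom C f) (prod_obj P X Y) \<and>
            proj1 P X Y \<cdot>\<^bsub>C\<^esub> h = f \<and> proj2 P X Y \<cdot>\<^bsub>C\<^esub> h = g)"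

definition prod_map :: "('o, 'm) category \<Rightarrow> ('o, 'm) binprod \<Rightarrow> 'm \<Rightarrow> 'm \<Rightarrow> 'm" where
  "prod_map C P f g = pairing C P
     (f \<cdot>\<^bsub>C\<^esub> proj1 P (Dom C f) (Dom C g)) (g \<cdot>\<^bsub>C\<^esub> proj2 P (Dom C f) (Dom C g))"

record ('o, 'm) endo =
  omap :: "'o \<Rightarrow> 'o"
  amap :: "'m \<Rightarrow> 'm"

definition endofunctor :: "('o, 'm) category \<Rightarrow> ('o, 'm) endo \<Rightarrow> bool" where
  "endofunctor C F \<longleftrightarrow>
     (\<forall>X \<in> Obj C. omap F X \<in> Obj C) \<and>
     (\<forall>X \<in> Obj C. \<forall>Y \<in> Obj C. \<forall>f \<in> hom C X Y. amap F f \<in> hom C (omap F X) (omap F Y)) \<and>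
     (\<forall>X \<in> Obj C. amap F (Ident C X) = Ident C (omap F X)) \<and>
     (\<forall>X \<in> Obj C. \<forall>Y \<in> Obj C. \<forall>Z \<in> Obj C. \<forall>f \<in> hom C X Y. \<forall>g \<in> hom C Y Z.
        amap F (g \<cdot>\<^bsub>C\<^esub> f) = amap F g \<cdot>\<^bsub>C\<^esub> amap F f)"

definition algebra :: "('o, 'm) category \<Rightarrow> ('o, 'm) endo \<Rightarrow> 'o \<Rightarrow> 'm \<Rightarrow> bool" where
  "algebra C F A a \<longleftrightarrow> A \<in> Obj C \<and> a \<in> hom C (omap F A) A"

definition algebra_hom ::
  "('o, 'm) category \<Rightarrow> ('o, 'm) endo \<Rightarrow> 'o \<Rightarrow> 'm \<Rightarrow> 'o \<Rightarrow> 'm \<Rightarrow> 'm \<Rightarrow> bool" where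
  "algebra_hom C F A a A' a' h \<longleftrightarrow>
     h \<in> hom C A A' \<and> h \<cdot>\<^bsub>C\<^esub> a = a' \<cdot>\<^bsub>C\<^esub> amap F h"

definition initial_algebra ::
  "('o, 'm) category \<Rightarrow> ('o, 'm) endo \<Rightarrow> 'o \<Rightarrow> 'm \<Rightarrow> bool" where
  "initial_algebra C F I i \<longleftrightarrow> algebra C F I i \<and>
     (\<forall>A a. algebra C F A a \<longrightarrow> (\<exists>!h. algebra_hom C F I i A a h))"

definition coalgebra :: "('o, 'm) category \<Rightarrow> ('o, 'm) endo \<Rightarrow> 'o \<Rightarrow> 'm \<Rightarrow> bool" where
  "coalgebra C F A c \<longleftrightarrow> A \<in> Obj C \<and> c \<in> hom C A (omap F A)"

definition coalgebra_hom ::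
  "('o, 'm) category \<Rightarrow> ('o, 'm) endo \<Rightarrow> 'o \<Rightarrow> 'm \<Rightarrow> 'o \<Rightarrow> 'm \<Rightarrow> 'm \<Rightarrow> bool" where
  "coalgebra_hom C F A c A' c' h \<longleftrightarrow>
     h \<in> hom C A A' \<and> c' \<cdot>\<^bsub>C\<^esub> h = amap F h \<cdot>\<^bsub>C\<^esub> c"

definition final_coalgebra ::
  "('o, 'm) category \<Rightarrow> ('o, 'm) endo \<Rightarrow> 'o \<Rightarrow> 'm \<Rightarrow> bool" where
  "final_coalgebra C F N t \<longleftrightarrow> coalgebra C F N t \<and>
     (\<forall>A c. coalgebra C F A c \<longrightarrow> (\<exists>!h. coalgebra_hom C F A c N t h))"

record ('o, 'm) free_algs =
  star_obj :: "'o \<Rightarrow> 'o"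
  star_alg :: "'o \<Rightarrow> 'm"
  star_unit :: "'o \<Rightarrow> 'm"

definition free_algebras ::
  "('o, 'm) category \<Rightarrow> ('o, 'm) endo \<Rightarrow> ('o, 'm) free_algs \<Rightarrow> bool" where
  "free_algebras C F S \<longleftrightarrow> (\<forall>X \<in> Obj C.
     algebra C F (star_obj S X) (star_alg S X) \<and>
     star_unit S X \<in> hom C X (star_obj S X) \<and>
     (\<forall>A a f. algebra C F A a \<and> f \<in> hom C X A \<longrightarrow>
        (\<exists>!h. algebra_hom C F (star_obj S X) (star_alg S X) A a h \<and>
              h \<cdot>\<^bsub>C\<^esub> star_unit S X = f)))"

definition free_extension ::
  "('o, 'm) category \<Rightarrow> ('o, 'm) endo \<Rightarrow> ('o, 'm) free_algs \<Rightarrow> 'o \<Rightarrow> 'm \<Rightarrow> 'm \<Rightarrow> 'm" where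
  "free_extension C F S A a f = (let X = Dom C f in
     THE h. algebra_hom C F (star_obj S X) (star_alg S X) A a h \<and>
            h \<cdot>\<^bsub>C\<^esub> star_unit S X = f)"

text \<open>The functor \<open>\<Sigma>\<^sup>\<star>\<close> of the free monad acts on \<open>f : X \<rightarrow> Y\<close> by extending \<open>\<eta>\<^sub>Y \<circ> f\<close> to \<open>\<Sigma>\<^sup>\<star>X\<close>.\<close>

definition star_map ::
  "('o, 'm) category \<Rightarrow> ('o, 'm) endo \<Rightarrow> ('o, 'm) free_algs \<Rightarrow> 'm \<Rightarrow> 'm" where
  "star_map C F S f = (let Y = Cod C f in
     free_extension C F S (star_obj S Y) (star_alg S Y) (star_unit S Y \<cdot>\<^bsub>C\<^esub> f))"

definition alg_hat ::
  "('o, 'm) category \<Rightarrow> ('o, 'm) endo \<Rightarrow> ('o, 'm) free_algs \<Rightarrow> 'o \<Rightarrow> 'm \<Rightarrow> 'm" where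
  "alg_hat C F S A a = free_extension C F S A a (Ident C A)"

definition pre_GSOS_law ::
  "('o, 'm) category \<Rightarrow> ('o, 'm) binprod \<Rightarrow> ('o, 'm) endo \<Rightarrow> ('o, 'm) free_algs \<Rightarrow>
   ('o, 'm) endo \<Rightarrow> ('o \<Rightarrow> 'm) \<Rightarrow> bool" where
  "pre_GSOS_law C P \<Sigma> S B \<rho> \<longleftrightarrow>
     (\<forall>X \<in> Obj C. \<rho> X \<in> hom C (omap \<Sigma> (prod_obj P X (omap B X))) (omap B (star_obj S X)))"

definition natural_wrt ::
  "('o, 'm) category \<Rightarrow> ('o, 'm) binprod \<Rightarrow> ('o, 'm) endo \<Rightarrow> ('o, 'm) free_algs \<Rightarrow>
   ('o, 'm) endo \<Rightarrow> ('o \<Rightarrow> 'm) \<Rightarrow> 'm \<Rightarrow> bool" where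
  "natural_wrt C P \<Sigma> S B \<rho> f \<longleftrightarrow>
     \<rho> (Cod C f) \<cdot>\<^bsub>C\<^esub> amap \<Sigma> (prod_map C P f (amap B f)) =
     amap B (star_map C \<Sigma> S f) \<cdot>\<^bsub>C\<^esub> \<rho> (Dom C f)"

text \<open>Existence and uniqueness of the operational model are consequences of initiality
  (primitive recursion on \<open>I\<close>) and are not assumed anywhere.\<close>

definition operational_model ::
  "('o, 'm) category \<Rightarrow> ('o, 'm) binprod \<Rightarrow> ('o, 'm) endo \<Rightarrow> ('o, 'm) free_algs \<Rightarrow>
   ('o, 'm) endo \<Rightarrow> ('o \<Rightarrow> 'm) \<Rightarrow> 'o \<Rightarrow> 'm \<Rightarrow> 'm" where
  "operational_model C P \<Sigma> S B \<rho> I i = (THE \<gamma>. \<gamma> \<in> hom C I (omap B I) \<and>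
     \<gamma> \<cdot>\<^bsub>C\<^esub> i =
       amap B (alg_hat C \<Sigma> S I i) \<cdot>\<^bsub>C\<^esub> \<rho> I \<cdot>\<^bsub>C\<^esub> amap \<Sigma> (pairing C P (Ident C I) \<gamma>))"

definition coalg_unfold ::
  "('o, 'm) category \<Rightarrow> ('o, 'm) endo \<Rightarrow> 'o \<Rightarrow> 'm \<Rightarrow> 'o \<Rightarrow> 'm \<Rightarrow> 'm" where
  "coalg_unfold C F N t A c = (THE h. coalgebra_hom C F A c N t h)"

definition beh ::
  "('o, 'm) category \<Rightarrow> ('o, 'm) binprod \<Rightarrow> ('o, 'm) endo \<Rightarrow> ('o, 'm) free_algs \<Rightarrow>
   ('o, 'm) endo \<Rightarrow> ('o \<Rightarrow> 'm) \<Rightarrow> 'o \<Rightarrow> 'm \<Rightarrow> 'o \<Rightarrow> 'm \<Rightarrow> 'm" where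
  "beh C P \<Sigma> S B \<rho> I i N t =
     coalg_unfold C B N t I (operational_model C P \<Sigma> S B \<rho> I i)"

definition morphic_congruence ::
  "('o, 'm) category \<Rightarrow> ('o, 'm) endo \<Rightarrow> 'o \<Rightarrow> 'm \<Rightarrow> 'o \<Rightarrow> 'm \<Rightarrow> bool" where
  "morphic_congruence C F A a A' h \<longleftrightarrow> algebra C F A a \<and> h \<in> hom C A A' \<and>
     (\<exists>a'. algebra C F A' a' \<and> h \<cdot>\<^bsub>C\<^esub> a = a' \<cdot>\<^bsub>C\<^esub> amap F h)"

end

theory Submission
  imports Defs
begin

text \<open>
  Primitive recursion on free algebras lifts every coalgebra \<open>c : X \<rightarrow> BX\<close> to a coalgebra
  \<open>c\<^sup># : \<Sigma>\<^sup>\<star>X \<rightarrow> B\<Sigma>\<^sup>\<star>X\<close> with \<open>c\<^sup># \<circ> \<eta> = B\<eta> \<circ> c\<close> and \<open>c\<^sup># \<circ> \<iota>\<^sub>X = B\<mu> \<circ> \<rho> \<circ> \<Sigma>\<langle>id, c\<^sup>#\<rangle>\<close>.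
  By the uniqueness part of primitive recursion, naturality of \<open>\<rho>\<close> at \<open>\<iota>^\<close> makes \<open>\<iota>^\<close> a coalgebra
  morphism \<open>\<gamma>\<^sup># \<rightarrow> \<gamma>\<close>, and naturality at \<open>\<Sigma>\<^sup>\<star>beh\<close> makes \<open>\<Sigma>\<^sup>\<star>beh\<close> a coalgebra morphism
  \<open>\<gamma>\<^sup># \<rightarrow> \<tau>\<^sup>#\<close>. If \<open>\<beta> : \<tau>\<^sup># \<rightarrow> \<tau>\<close> is the unique morphism, then finality gives
  \<open>\<beta> \<circ> \<Sigma>\<^sup>\<star>beh = beh \<circ> \<iota>^\<close>, and \<open>\<beta> \<circ> \<iota>\<^sub>\<nu>\<^sub>B \<circ> \<Sigma>\<eta>\<close> is the required algebra structure on \<open>\<nu>B\<close>.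
\<close>

section \<open>Equational calculus of arrows and functors\<close>

context category
begin

text \<open>Phrased with \<open>Arr\<close>, \<open>Dom\<close> and \<open>Cod\<close> instead of
  \<open>hom\<close>, the axioms leave no intermediate object for the simplifier to guess: side
  conditions become equations and memberships that rewriting can settle. Composites are normalised
  to right-nested form.\<close>

lemma Comp_Arr: "f \<in> Arr C \<Longrightarrow> g \<in> Arr C \<Longrightarrow> Dom C g = Cod C f \<Longrightarrow> g \<cdot> f \<in> Arr C"
  and Dom_Comp: "f \<in> Arr C \<Longrightarrow> g \<in> Arr C \<Longrightarrow> Dom C g = Cod C f \<Longrightarrow> Dom C (g \<cdot> f) = Dom C f"
  and Cod_Comp: "f \<in> Arr C \<Longrightarrow> g \<in> Arr C \<Longrightarrow> Dom C g = Cod C f \<Longrightarrow> Cod C (g \<cdot> f) = Cod C g"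
  using Comp_in_hom[of f "Dom C f" "Cod C f" g "Cod C g"] by (auto simp: hom_def)

lemma Comp_assoc_Arr:
  "f \<in> Arr C \<Longrightarrow> g \<in> Arr C \<Longrightarrow> h \<in> Arr C \<Longrightarrow> Dom C g = Cod C f \<Longrightarrow> Dom C h = Cod C g \<Longrightarrow>
    (h \<cdot> g) \<cdot> f = h \<cdot> (g \<cdot> f)"
  by (rule Comp_assoc) (auto simp: hom_def)

lemma Ident_Arr: "X \<in> Obj C \<Longrightarrow> Ident C X \<in> Arr C"
  and Dom_Ident: "X \<in> Obj C \<Longrightarrow> Dom C (Ident C X) = X"
  and Cod_Ident: "X \<in> Obj C \<Longrightarrow> Cod C (Ident C X) = X"
  using Id_in_hom by (auto simp: hom_def)

lemma Comp_Ident_right: "f \<in> Arr C \<Longrightarrow> Dom C f = X \<Longrightarrow> f \<cdot> Ident C X = f"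
  and Comp_Ident_left: "f \<in> Arr C \<Longrightarrow> Cod C f = X \<Longrightarrow> Ident C X \<cdot> f = f"
  using Comp_Id_right Comp_Id_left by (auto simp: hom_def)

lemmas arr_simps = Comp_Arr Dom_Comp Cod_Comp Comp_assoc_Arr Ident_Arr Dom_Ident Cod_Ident
  Comp_Ident_right Comp_Ident_left Dom_in_Obj Cod_in_Obj

lemma endofunctor_simps:
  assumes "endofunctor C F"
  shows "X \<in> Obj C \<Longrightarrow> omap F X \<in> Obj C"
    and "f \<in> Arr C \<Longrightarrow> amap F f \<in> Arr C"
    and "f \<in> Arr C \<Longrightarrow> Dom C (amap F f) = omap F (Dom C f)"
    and "f \<in> Arr C \<Longrightarrow> Cod C (amap F f) = omap F (Cod C f)"
    and "X \<in> Obj C \<Longrightarrow> amap F (Ident C X) = Ident C (omap F X)"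
    and "f \<in> Arr C \<Longrightarrow> g \<in> Arr C \<Longrightarrow> Dom C g = Cod C f \<Longrightarrow>
      amap F (g \<cdot> f) = amap F g \<cdot> amap F f"
proof -
  note F = assms[unfolded endofunctor_def]
  show "omap F X \<in> Obj C" "amap F (Ident C X) = Ident C (omap F X)" if "X \<in> Obj C"
    using F that by blast+
  have "amap F f \<in> hom C (omap F (Dom C f)) (omap F (Cod C f))" if "f \<in> Arr C"
    using F Dom_in_Obj[OF that] Cod_in_Obj[OF that] that by (simp add: hom_def)
  then show "amap F f \<in> Arr C" "Dom C (amap F f) = omap F (Dom C f)"
    "Cod C (amap F f) = omap F (Cod C f)" if "f \<in> Arr C"
    using that by (auto simp: hom_def)
  show "amap F (g \<cdot> f) = amap F g \<cdot> amap F f"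
    if "f \<in> Arr C" "g \<in> Arr C" "Dom C g = Cod C f"
    using F Dom_in_Obj[OF that(1)] Cod_in_Obj[OF that(1)] Cod_in_Obj[OF that(2)] that
    by (simp add: hom_def)
qed

end

section \<open>Binary products and pairings\<close>

locale pre_GSOS = category C for C :: "('o, 'm) category" (structure) +
  fixes P :: "('o, 'm) binprod"
    and \<Sigma> B :: "('o, 'm) endo"
    and S :: "('o, 'm) free_algs"
    and \<rho> :: "'o \<Rightarrow> 'm"
  assumes products: "binary_products C P"
    and endofunctor_\<Sigma>: "endofunctor C \<Sigma>"
    and endofunctor_B: "endofunctor C B"
    and free: "free_algebras C \<Sigma> S"
    and law: "pre_GSOS_law C P \<Sigma> S B \<rho>"
begin

lemmas functor_simps = endofunctor_simps[OF endofunctor_\<Sigma>] endofunctor_simps[OF endofunctor_B]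

lemma prod_simps:
  assumes "X \<in> Obj C" "Y \<in> Obj C"
  shows "prod_obj P X Y \<in> Obj C"
    and "proj1 P X Y \<in> Arr C"
    and "Dom C (proj1 P X Y) = prod_obj P X Y"
    and "Cod C (proj1 P X Y) = X"
    and "proj2 P X Y \<in> Arr C"
    and "Dom C (proj2 P X Y) = prod_obj P X Y"
    and "Cod C (proj2 P X Y) = Y"
proof -
  have "prod_obj P X Y \<in> Obj C \<and> proj1 P X Y \<in> hom C (prod_obj P X Y) X \<and>
      proj2 P X Y \<in> hom C (prod_obj P X Y) Y"
    using products assms unfolding binary_products_def by blast
  then show "prod_obj P X Y \<in> Obj C"
    and "proj1 P X Y \<in> Arr C"
    and "Dom C (proj1 P X Y) = prod_obj P X Y"
    and "Cod C (proj1 P X Y) = X"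
    and "proj2 P X Y \<in> Arr C"
    and "Dom C (proj2 P X Y) = prod_obj P X Y"
    and "Cod C (proj2 P X Y) = Y"
    by (simp_all add: hom_def)
qed

text \<open>The objects are written as codomains, so that the unique existence matches the definite
  description in \<open>pairing\<close> literally.\<close>

lemma pairing_ex1:
  assumes "f \<in> Arr C" "g \<in> Arr C" "Dom C g = Dom C f"
  shows "\<exists>!h. h \<in> hom C (Dom C f) (prod_obj P (Cod C f) (Cod C g)) \<and>
    proj1 P (Cod C f) (Cod C g) \<cdot> h = f \<and> proj2 P (Cod C f) (Cod C g) \<cdot> h = g"
proof -
  have "f \<in> hom C (Dom C f) (Cod C f)" "g \<in> hom C (Dom C f) (Cod C g)"
    using assms by (auto simp: hom_def)
  then show ?thesis
    using products Dom_in_Obj[OF assms(1)] Cod_in_Obj[OF assms(1)] Cod_in_Obj[OF assms(2)]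
    unfolding binary_products_def by blast
qed

text \<open>The two projection rules take X and Y through premises rather than as
  \<open>Cod C f\<close> and \<open>Cod C g\<close>; they still match after the codomains have been
  simplified.\<close>

lemma pairing_simps:
  assumes "f \<in> Arr C" "g \<in> Arr C" "Dom C g = Dom C f"
  shows "pairing C P f g \<in> Arr C"
    and "Dom C (pairing C P f g) = Dom C f"
    and "Cod C (pairing C P f g) = prod_obj P (Cod C f) (Cod C g)"
    and "Cod C f = X \<Longrightarrow> Cod C g = Y \<Longrightarrow> proj1 P X Y \<cdot> pairing C P f g = f"
    and "Cod C f = X \<Longrightarrow> Cod C g = Y \<Longrightarrow> proj2 P X Y \<cdot> pairing C P f g = g"
  using theI'[OF pairing_ex1[OF assms]] unfolding pairing_def Let_def hom_def by simp_all

text \<open>Only h needs typing: the equations force the types of f and g, since these are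
  composites of h with projections.\<close>

lemma pairing_eqI:
  assumes "h \<in> Arr C" "X \<in> Obj C" "Y \<in> Obj C" "Cod C h = prod_obj P X Y"
    and "proj1 P X Y \<cdot> h = f" "proj2 P X Y \<cdot> h = g"
  shows "h = pairing C P f g"
proof -
  have fg: "f \<in> Arr C" "g \<in> Arr C" "Dom C f = Dom C h" "Dom C g = Dom C h" "Cod C f = X" "Cod C g = Y"
    using assms by (auto simp: arr_simps prod_simps)
  have "h \<in> hom C (Dom C f) (prod_obj P (Cod C f) (Cod C g)) \<and>
      proj1 P (Cod C f) (Cod C g) \<cdot> h = f \<and> proj2 P (Cod C f) (Cod C g) \<cdot> h = g"
    using assms fg by (simp add: hom_def)
  moreover have "pairing C P f g \<in> hom C (Dom C f) (prod_obj P (Cod C f) (Cod C g)) \<and>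
      proj1 P (Cod C f) (Cod C g) \<cdot> pairing C P f g = f \<and>
      proj2 P (Cod C f) (Cod C g) \<cdot> pairing C P f g = g"
    using fg by (simp add: hom_def pairing_simps)
  ultimately show ?thesis
    using pairing_ex1[of f g] fg by auto
qed

lemma pairing_Comp:
  assumes "f \<in> Arr C" "g \<in> Arr C" "Dom C g = Dom C f" "k \<in> Arr C" "Cod C k = Dom C f"
  shows "pairing C P f g \<cdot> k = pairing C P (f \<cdot> k) (g \<cdot> k)"
proof (rule pairing_eqI)
  show "proj1 P (Cod C f) (Cod C g) \<cdot> pairing C P f g \<cdot> k = f \<cdot> k"
    "proj2 P (Cod C f) (Cod C g) \<cdot> pairing C P f g \<cdot> k = g \<cdot> k"
    \<comment> \<open>Associativity is reversed here, so that each projection meets the pairing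
      before k is attached.\<close>
    using assms by (simp_all add: arr_simps prod_simps pairing_simps flip: Comp_assoc_Arr)
qed (use assms in \<open>simp_all add: arr_simps pairing_simps\<close>)

lemma prod_map_simps:
  assumes "f \<in> Arr C" "g \<in> Arr C"
  shows "prod_map C P f g \<in> Arr C"
    and "Dom C (prod_map C P f g) = prod_obj P (Dom C f) (Dom C g)"
    and "Cod C (prod_map C P f g) = prod_obj P (Cod C f) (Cod C g)"
  using assms by (simp_all add: prod_map_def arr_simps prod_simps pairing_simps)

lemma prod_map_pairing:
  assumes "f \<in> Arr C" "g \<in> Arr C" "h \<in> Arr C" "k \<in> Arr C"
    and "Dom C f = Cod C h" "Dom C g = Cod C k" "Dom C k = Dom C h"
  shows "prod_map C P f g \<cdot> pairing C P h k = pairing C P (f \<cdot> h) (g \<cdot> k)"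
  using assms by (simp add: prod_map_def arr_simps prod_simps pairing_simps pairing_Comp)

section \<open>Free algebras, evaluation maps and the action of the free monad\<close>

lemma star_simps:
  assumes "X \<in> Obj C"
  shows "star_obj S X \<in> Obj C"
    and "star_alg S X \<in> Arr C"
    and "Dom C (star_alg S X) = omap \<Sigma> (star_obj S X)"
    and "Cod C (star_alg S X) = star_obj S X"
    and "star_unit S X \<in> Arr C"
    and "Dom C (star_unit S X) = X"
    and "Cod C (star_unit S X) = star_obj S X"
proof -
  have "algebra C \<Sigma> (star_obj S X) (star_alg S X) \<and> star_unit S X \<in> hom C X (star_obj S X)"
    using free assms unfolding free_algebras_def by blast
  then show "star_obj S X \<in> Obj C"
    and "star_alg S X \<in> Arr C"
    and "Dom C (star_alg S X) = omap \<Sigma> (star_obj S X)"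
    and "Cod C (star_alg S X) = star_obj S X"
    and "star_unit S X \<in> Arr C"
    and "Dom C (star_unit S X) = X"
    and "Cod C (star_unit S X) = star_obj S X"
    by (simp_all add: algebra_def hom_def)
qed

lemma law_simps:
  assumes "X \<in> Obj C"
  shows "\<rho> X \<in> Arr C"
    and "Dom C (\<rho> X) = omap \<Sigma> (prod_obj P X (omap B X))"
    and "Cod C (\<rho> X) = omap B (star_obj S X)"
  using law assms by (simp_all add: pre_GSOS_law_def hom_def)

lemmas all_simps = arr_simps functor_simps prod_simps pairing_simps prod_map_simps star_simps law_simps

lemma free_ex1:
  assumes "X \<in> Obj C" "algebra C \<Sigma> A a" "f \<in> hom C X A"
  shows "\<exists>!h. algebra_hom C \<Sigma> (star_obj S X) (star_alg S X) A a h \<and> h \<cdot> star_unit S X = f"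
  using free assms unfolding free_algebras_def by blast

lemma free_extension:
  assumes "algebra C \<Sigma> A a" "f \<in> Arr C" "Cod C f = A" "Dom C f = X"
  shows "algebra_hom C \<Sigma> (star_obj S X) (star_alg S X) A a (free_extension C \<Sigma> S A a f)"
    and "free_extension C \<Sigma> S A a f \<cdot> star_unit S X = f"
proof -
  have "X \<in> Obj C" "f \<in> hom C X A"
    using assms Dom_in_Obj by (auto simp: hom_def)
  from theI'[OF free_ex1[OF this(1) assms(1) this(2)]] assms(4)
  show "algebra_hom C \<Sigma> (star_obj S X) (star_alg S X) A a (free_extension C \<Sigma> S A a f)"
    and "free_extension C \<Sigma> S A a f \<cdot> star_unit S X = f"
    by (auto simp: free_extension_def Let_def)
qed

lemma algebra_star: "X \<in> Obj C \<Longrightarrow> algebra C \<Sigma> (star_obj S X) (star_alg S X)"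
  by (simp add: algebra_def hom_def star_simps)

lemma algebra_hom_Comp:
  assumes "algebra C \<Sigma> A1 a1" "algebra C \<Sigma> A2 a2" "algebra C \<Sigma> A3 a3"
    and "algebra_hom C \<Sigma> A1 a1 A2 a2 f" "algebra_hom C \<Sigma> A2 a2 A3 a3 g"
  shows "algebra_hom C \<Sigma> A1 a1 A3 a3 (g \<cdot> f)"
proof -
  have t: "f \<in> Arr C" "Dom C f = A1" "Cod C f = A2" "g \<in> Arr C" "Dom C g = A2" "Cod C g = A3"
    "a1 \<in> Arr C" "Dom C a1 = omap \<Sigma> A1" "Cod C a1 = A1" "a2 \<in> Arr C" "Dom C a2 = omap \<Sigma> A2"
    "Cod C a2 = A2" "a3 \<in> Arr C" "Dom C a3 = omap \<Sigma> A3" "Cod C a3 = A3"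
    and f: "f \<cdot> a1 = a2 \<cdot> amap \<Sigma> f" and g: "g \<cdot> a2 = a3 \<cdot> amap \<Sigma> g"
    using assms by (auto simp: algebra_def algebra_hom_def hom_def)
  have "(g \<cdot> f) \<cdot> a1 = (g \<cdot> a2) \<cdot> amap \<Sigma> f"
    using t by (simp add: all_simps f)
  also have "\<dots> = a3 \<cdot> amap \<Sigma> (g \<cdot> f)"
    unfolding g using t by (simp add: all_simps)
  finally show ?thesis
    using t by (simp add: algebra_hom_def hom_def all_simps)
qed

lemma alg_hat:
  assumes "algebra C \<Sigma> A a"
  shows "algebra_hom C \<Sigma> (star_obj S A) (star_alg S A) A a (alg_hat C \<Sigma> S A a)"
    and "alg_hat C \<Sigma> S A a \<cdot> star_unit S A = Ident C A"
proof -
  have "A \<in> Obj C" using assms by (simp add: algebra_def)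
  then show "algebra_hom C \<Sigma> (star_obj S A) (star_alg S A) A a (alg_hat C \<Sigma> S A a)"
    and "alg_hat C \<Sigma> S A a \<cdot> star_unit S A = Ident C A"
    unfolding alg_hat_def by (auto intro!: free_extension assms simp: arr_simps)
qed

lemma star_map:
  assumes "f \<in> Arr C" "Dom C f = X" "Cod C f = Y"
  shows "algebra_hom C \<Sigma> (star_obj S X) (star_alg S X) (star_obj S Y) (star_alg S Y)
      (star_map C \<Sigma> S f)"
    and "star_map C \<Sigma> S f \<cdot> star_unit S X = star_unit S Y \<cdot> f"
proof -
  have "Y \<in> Obj C" using assms Cod_in_Obj by auto
  then show "algebra_hom C \<Sigma> (star_obj S X) (star_alg S X) (star_obj S Y) (star_alg S Y)
      (star_map C \<Sigma> S f)"
    and "star_map C \<Sigma> S f \<cdot> star_unit S X = star_unit S Y \<cdot> f"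
    unfolding star_map_def Let_def assms(3)
    using assms by (auto intro!: free_extension algebra_star simp: arr_simps star_simps)
qed

lemma alg_hat_simps:
  assumes "algebra C \<Sigma> A a"
  shows "alg_hat C \<Sigma> S A a \<in> Arr C"
    and "Dom C (alg_hat C \<Sigma> S A a) = star_obj S A"
    and "Cod C (alg_hat C \<Sigma> S A a) = A"
  using alg_hat(1)[OF assms] by (auto simp: algebra_hom_def hom_def)

lemma star_map_simps:
  assumes "f \<in> Arr C"
  shows "star_map C \<Sigma> S f \<in> Arr C"
    and "Dom C (star_map C \<Sigma> S f) = star_obj S (Dom C f)"
    and "Cod C (star_map C \<Sigma> S f) = star_obj S (Cod C f)"
  using star_map(1)[OF assms refl refl] by (auto simp: algebra_hom_def hom_def)

text \<open>Both sides are algebra morphisms out of the free algebra on A, and both restrict to h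
  along the unit. This is what moves a morphism past the monad multiplication later.\<close>

lemma algebra_hom_alg_hat_natural:
  assumes A: "algebra C \<Sigma> A a" and A': "algebra C \<Sigma> A' a'" and h: "algebra_hom C \<Sigma> A a A' a' h"
  shows "h \<cdot> alg_hat C \<Sigma> S A a = alg_hat C \<Sigma> S A' a' \<cdot> star_map C \<Sigma> S h"
proof -
  have t: "A \<in> Obj C" "A' \<in> Obj C" "h \<in> Arr C" "Dom C h = A" "Cod C h = A'"
    using assms by (auto simp: algebra_def algebra_hom_def hom_def)
  have "h \<in> hom C A A'"
    using t by (simp add: hom_def)
  note ex1 = free_ex1[OF t(1) A' this]
  have "(h \<cdot> alg_hat C \<Sigma> S A a) \<cdot> star_unit S A = h"
    using t A by (simp add: all_simps alg_hat_simps alg_hat)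
  moreover have "(alg_hat C \<Sigma> S A' a' \<cdot> star_map C \<Sigma> S h) \<cdot> star_unit S A = h"
  proof -
    have "(alg_hat C \<Sigma> S A' a' \<cdot> star_map C \<Sigma> S h) \<cdot> star_unit S A
        = (alg_hat C \<Sigma> S A' a' \<cdot> star_unit S A') \<cdot> h"
      using t A' by (simp add: all_simps alg_hat_simps star_map_simps star_map)
    then show ?thesis
      using t A' by (simp add: all_simps alg_hat)
  qed
  ultimately show ?thesis
    using ex1 algebra_hom_Comp[OF algebra_star[OF t(1)] A A' alg_hat(1)[OF A] h]
      algebra_hom_Comp[OF algebra_star[OF t(1)] algebra_star[OF t(2)] A' star_map(1)[OF t(3-5)] alg_hat(1)[OF A']]
    by blast
qed

section \<open>Primitive recursion on initial and free algebras, and the operational model\<close>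

definition pair_alg :: "'o \<Rightarrow> 'm \<Rightarrow> 'o \<Rightarrow> 'm \<Rightarrow> 'm" where
  "pair_alg A a Z g = pairing C P (a \<cdot> amap \<Sigma> (proj1 P A Z)) g"

lemma algebra_pair_alg:
  assumes "algebra C \<Sigma> A a" "Z \<in> Obj C" "g \<in> hom C (omap \<Sigma> (prod_obj P A Z)) Z"
  shows "algebra C \<Sigma> (prod_obj P A Z) (pair_alg A a Z g)"
  using assms by (simp add: algebra_def pair_alg_def hom_def all_simps)

lemma algebra_hom_proj1:
  assumes "algebra C \<Sigma> A a" "Z \<in> Obj C" "g \<in> hom C (omap \<Sigma> (prod_obj P A Z)) Z"
  shows "algebra_hom C \<Sigma> (prod_obj P A Z) (pair_alg A a Z g) A a (proj1 P A Z)"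
  using assms by (simp add: algebra_def algebra_hom_def pair_alg_def hom_def all_simps)

text \<open>Reduces primitive recursion to ordinary initiality or freeness. In
  \<open>pair_alg\<close> the first component evaluates by a and forgets the Z-part, while the
  second is the recursion step g, which sees both parts. Comparing the two projections splits the
  morphism condition into the one for h and the recursive equation for k.\<close>

lemma algebra_hom_pairing_iff:
  assumes "algebra C \<Sigma> I i" "algebra C \<Sigma> A a" "g \<in> hom C (omap \<Sigma> (prod_obj P A Z)) Z"
    and "h \<in> hom C I A" "k \<in> hom C I Z"
  shows "algebra_hom C \<Sigma> I i (prod_obj P A Z) (pair_alg A a Z g) (pairing C P h k) \<longleftrightarrow>
    algebra_hom C \<Sigma> I i A a h \<and> k \<cdot> i = g \<cdot> amap \<Sigma> (pairing C P h k)"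
proof -
  have t: "I \<in> Obj C" "i \<in> Arr C" "Dom C i = omap \<Sigma> I" "Cod C i = I" "A \<in> Obj C" "a \<in> Arr C"
    "Dom C a = omap \<Sigma> A" "Cod C a = A" "Z \<in> Obj C" "g \<in> Arr C" "Dom C g = omap \<Sigma> (prod_obj P A Z)"
    "Cod C g = Z" "h \<in> Arr C" "Dom C h = I" "Cod C h = A" "k \<in> Arr C" "Dom C k = I" "Cod C k = Z"
    using assms Cod_in_Obj by (auto simp: algebra_def hom_def)
  have 1: "pairing C P h k \<cdot> i = pairing C P (h \<cdot> i) (k \<cdot> i)"
    using t by (simp add: pairing_Comp)
  have "pair_alg A a Z g \<cdot> amap \<Sigma> (pairing C P h k) =
      pairing C P (a \<cdot> amap \<Sigma> (proj1 P A Z \<cdot> pairing C P h k)) (g \<cdot> amap \<Sigma> (pairing C P h k))"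
    \<comment> \<open>With the first projection rule active, the right side would collapse to
      \<open>amap \<Sigma> h\<close> while the left keeps two separate \<open>amap\<close> factors;
      the rule is applied only afterwards.\<close>
    using t by (simp add: pair_alg_def pairing_Comp all_simps del: pairing_simps(4))
  then have 2: "pair_alg A a Z g \<cdot> amap \<Sigma> (pairing C P h k) =
      pairing C P (a \<cdot> amap \<Sigma> h) (g \<cdot> amap \<Sigma> (pairing C P h k))"
    using t by (simp add: all_simps)
  have "pairing C P (h \<cdot> i) (k \<cdot> i) = pairing C P (a \<cdot> amap \<Sigma> h) (g \<cdot> amap \<Sigma> (pairing C P h k)) \<longleftrightarrow>
      h \<cdot> i = a \<cdot> amap \<Sigma> h \<and> k \<cdot> i = g \<cdot> amap \<Sigma> (pairing C P h k)" (is "?l \<longleftrightarrow> ?r")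
  proof
    assume ?l
    from arg_cong[OF this, of "\<lambda>x. proj1 P A Z \<cdot> x"] arg_cong[OF this, of "\<lambda>x. proj2 P A Z \<cdot> x"]
    show ?r using t by (simp add: all_simps)
  qed simp
  then show ?thesis
    unfolding algebra_hom_def 1 2 using t by (auto simp: hom_def all_simps)
qed

text \<open>The unique morphism h into \<open>pair_alg\<close> has as first component an
  endomorphism of the initial algebra, hence the identity, and its second component solves the
  equation. Conversely, every solution paired with the identity is such a morphism, so it gives h
  again.\<close>

lemma primitive_recursion_initial:
  assumes init: "initial_algebra C \<Sigma> I i" and Z: "Z \<in> Obj C"
    and g: "g \<in> hom C (omap \<Sigma> (prod_obj P I Z)) Z"
  shows "\<exists>!k. k \<in> hom C I Z \<and> k \<cdot> i = g \<cdot> amap \<Sigma> (pairing C P (Ident C I) k)"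
proof -
  have I: "algebra C \<Sigma> I i" and ex1: "\<And>A a. algebra C \<Sigma> A a \<Longrightarrow> \<exists>!h. algebra_hom C \<Sigma> I i A a h"
    using init by (auto simp: initial_algebra_def)
  have t: "I \<in> Obj C" "i \<in> Arr C" "Dom C i = omap \<Sigma> I" "Cod C i = I"
    using I by (auto simp: algebra_def hom_def)
  let ?a = "pair_alg I i Z g"
  have id: "algebra_hom C \<Sigma> I i I i (Ident C I)"
    using t by (simp add: algebra_hom_def hom_def all_simps)
  have iff: "algebra_hom C \<Sigma> I i (prod_obj P I Z) ?a (pairing C P (Ident C I) k) \<longleftrightarrow>
      k \<cdot> i = g \<cdot> amap \<Sigma> (pairing C P (Ident C I) k)" if "k \<in> hom C I Z" for k
    using algebra_hom_pairing_iff[OF I I g Id_in_hom[OF t(1)] that] id by simp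
  note alg = algebra_pair_alg[OF I Z g]
  obtain h where h: "algebra_hom C \<Sigma> I i (prod_obj P I Z) ?a h"
    using ex1[OF alg] by blast
  then have th: "h \<in> Arr C" "Dom C h = I" "Cod C h = prod_obj P I Z"
    by (auto simp: algebra_hom_def hom_def)
  have "proj1 P I Z \<cdot> h = Ident C I"
    using ex1[OF I] id algebra_hom_Comp[OF I alg I h algebra_hom_proj1[OF I Z g]] by blast
  then have hp: "h = pairing C P (Ident C I) (proj2 P I Z \<cdot> h)"
    by (intro pairing_eqI[of _ I Z]) (use t Z th in auto)
  have k: "proj2 P I Z \<cdot> h \<in> hom C I Z"
    using th t Z by (simp add: hom_def all_simps)
  show ?thesis
  proof (rule ex1I[of _ "proj2 P I Z \<cdot> h"])
    show "proj2 P I Z \<cdot> h \<in> hom C I Z \<and>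
        (proj2 P I Z \<cdot> h) \<cdot> i = g \<cdot> amap \<Sigma> (pairing C P (Ident C I) (proj2 P I Z \<cdot> h))"
      using k iff[OF k] h hp by simp
  next
    fix k' assume k': "k' \<in> hom C I Z \<and> k' \<cdot> i = g \<cdot> amap \<Sigma> (pairing C P (Ident C I) k')"
    then have "pairing C P (Ident C I) k' = h"
      using iff[of k'] ex1[OF alg] h by blast
    then show "k' = proj2 P I Z \<cdot> h"
      using k' t by (auto simp: hom_def all_simps)
  qed
qed

text \<open>The pairings of h with k and with k' are algebra morphisms from a free algebra to the
  same \<open>pair_alg\<close>, and they agree on generators. The morphism h is arbitrary, so that
  solutions along the evaluation map and along \<open>star_map\<close> can both be compared.\<close>

lemma primitive_recursion_free_unique:
  assumes X: "X \<in> Obj C" and A: "algebra C \<Sigma> A a" and Z: "Z \<in> Obj C"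
    and g: "g \<in> hom C (omap \<Sigma> (prod_obj P A Z)) Z"
    and h: "algebra_hom C \<Sigma> (star_obj S X) (star_alg S X) A a h"
    and k: "k \<in> hom C (star_obj S X) Z" and k': "k' \<in> hom C (star_obj S X) Z"
    and unit: "k \<cdot> star_unit S X = k' \<cdot> star_unit S X"
    and step: "k \<cdot> star_alg S X = g \<cdot> amap \<Sigma> (pairing C P h k)"
    and step': "k' \<cdot> star_alg S X = g \<cdot> amap \<Sigma> (pairing C P h k')"
  shows "k = k'"
proof -
  have hh: "h \<in> hom C (star_obj S X) A"
    using h by (simp add: algebra_hom_def)
  have t: "h \<in> Arr C" "Dom C h = star_obj S X" "Cod C h = A"
    "k \<in> Arr C" "Dom C k = star_obj S X" "Cod C k = Z"
    "k' \<in> Arr C" "Dom C k' = star_obj S X" "Cod C k' = Z" "A \<in> Obj C"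
    using hh k k' A by (auto simp: hom_def algebra_def)
  note iff = algebra_hom_pairing_iff[OF algebra_star[OF X] A g hh]
  note alg = algebra_pair_alg[OF A Z g]
  have f: "pairing C P (h \<cdot> star_unit S X) (k \<cdot> star_unit S X) \<in> hom C X (prod_obj P A Z)"
    using t X Z by (simp add: hom_def all_simps)
  have "pairing C P h k \<cdot> star_unit S X = pairing C P (h \<cdot> star_unit S X) (k \<cdot> star_unit S X)"
    "pairing C P h k' \<cdot> star_unit S X = pairing C P (h \<cdot> star_unit S X) (k \<cdot> star_unit S X)"
    using t X by (simp_all add: pairing_Comp star_simps unit)
  then have "pairing C P h k = pairing C P h k'"
    using free_ex1[OF X alg f] iff[OF k] iff[OF k'] h step step' by blast
  from arg_cong[OF this, of "\<lambda>x. proj2 P A Z \<cdot> x"] show ?thesis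
    using t by (simp add: pairing_simps)
qed

text \<open>As in the initial case, but the first component of the extension h is recognised as the
  identity because it restricts to the unit on generators; z prescribes the second component
  there.\<close>

lemma primitive_recursion_free_exists:
  assumes X: "X \<in> Obj C" and Z: "Z \<in> Obj C"
    and g: "g \<in> hom C (omap \<Sigma> (prod_obj P (star_obj S X) Z)) Z" and z: "z \<in> hom C X Z"
  obtains k where "k \<in> hom C (star_obj S X) Z" "k \<cdot> star_unit S X = z"
    "k \<cdot> star_alg S X = g \<cdot> amap \<Sigma> (pairing C P (Ident C (star_obj S X)) k)"
proof -
  let ?I = "star_obj S X" and ?i = "star_alg S X"
  have I: "algebra C \<Sigma> ?I ?i" using X by (rule algebra_star)
  have tz: "z \<in> Arr C" "Dom C z = X" "Cod C z = Z" using z by (auto simp: hom_def)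
  have IO: "?I \<in> Obj C" using X by (rule star_simps)
  note alg = algebra_pair_alg[OF I Z g]
  have "pairing C P (star_unit S X) z \<in> hom C X (prod_obj P ?I Z)"
    using tz X Z by (simp add: hom_def all_simps)
  from free_ex1[OF X alg this] obtain h
    where h: "algebra_hom C \<Sigma> ?I ?i (prod_obj P ?I Z) (pair_alg ?I ?i Z g) h"
      and hu: "h \<cdot> star_unit S X = pairing C P (star_unit S X) z" by blast
  then have th: "h \<in> Arr C" "Dom C h = ?I" "Cod C h = prod_obj P ?I Z"
    by (auto simp: algebra_hom_def hom_def)
  have id: "algebra_hom C \<Sigma> ?I ?i ?I ?i (Ident C ?I)"
    using X by (simp add: algebra_hom_def hom_def all_simps)
  have u: "star_unit S X \<in> hom C X ?I" using X by (simp add: hom_def star_simps)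
  have "(proj1 P ?I Z \<cdot> h) \<cdot> star_unit S X = star_unit S X"
    using th tz X Z hu by (simp add: all_simps)
  moreover have "Ident C ?I \<cdot> star_unit S X = star_unit S X"
    using X by (simp add: all_simps)
  ultimately have "proj1 P ?I Z \<cdot> h = Ident C ?I"
    using free_ex1[OF X I u] id algebra_hom_Comp[OF I alg I h algebra_hom_proj1[OF I Z g]] by blast
  then have hp: "h = pairing C P (Ident C ?I) (proj2 P ?I Z \<cdot> h)"
    by (intro pairing_eqI[of _ ?I Z]) (use IO Z th in auto)
  have k: "proj2 P ?I Z \<cdot> h \<in> hom C ?I Z"
    using th IO Z by (simp add: hom_def all_simps)
  show ?thesis
  proof (rule that[OF k])
    show "(proj2 P ?I Z \<cdot> h) \<cdot> star_unit S X = z"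
      using th tz X Z hu by (simp add: all_simps)
    show "(proj2 P ?I Z \<cdot> h) \<cdot> ?i = g \<cdot> amap \<Sigma> (pairing C P (Ident C ?I) (proj2 P ?I Z \<cdot> h))"
      using algebra_hom_pairing_iff[OF I I g Id_in_hom[OF IO] k] h hp by simp
  qed
qed

text \<open>Primitive recursion with step
  \<open>amap B (alg_hat C \<Sigma> S I i) \<cdot> \<rho> I\<close> justifies the definite
  description.\<close>

lemma operational_model:
  assumes "initial_algebra C \<Sigma> I i"
  defines "\<gamma> \<equiv> operational_model C P \<Sigma> S B \<rho> I i"
  shows "\<gamma> \<in> hom C I (omap B I)"
    and "\<gamma> \<cdot> i = amap B (alg_hat C \<Sigma> S I i) \<cdot> \<rho> I \<cdot> amap \<Sigma> (pairing C P (Ident C I) \<gamma>)"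
proof -
  have A: "algebra C \<Sigma> I i" and I: "I \<in> Obj C"
    using assms(1) by (auto simp: initial_algebra_def algebra_def)
  let ?g = "amap B (alg_hat C \<Sigma> S I i) \<cdot> \<rho> I"
  have g: "?g \<in> hom C (omap \<Sigma> (prod_obj P I (omap B I))) (omap B I)"
    using A I by (simp add: hom_def all_simps alg_hat_simps)
  \<comment> \<open>The defining equation is nested to the right, whereas the recursion principle
    wants the step as one morphism; for well-typed k the two bracketings agree.\<close>
  have "?g \<cdot> amap \<Sigma> (pairing C P (Ident C I) k) =
      amap B (alg_hat C \<Sigma> S I i) \<cdot> \<rho> I \<cdot> amap \<Sigma> (pairing C P (Ident C I) k)"
    if "k \<in> hom C I (omap B I)" for k
    using that A I by (simp add: hom_def all_simps alg_hat_simps)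
  then have "\<exists>!\<gamma>. \<gamma> \<in> hom C I (omap B I) \<and>
      \<gamma> \<cdot> i = amap B (alg_hat C \<Sigma> S I i) \<cdot> \<rho> I \<cdot> amap \<Sigma> (pairing C P (Ident C I) \<gamma>)"
    \<comment> \<open>\<open>functor_simps(7)\<close> opens the half of the rules that concerns
      \<open>B\<close>: it says that \<open>omap B I\<close> is an object.\<close>
    using primitive_recursion_initial[OF assms(1) _ g] functor_simps(7)[OF I] by (metis (no_types, lifting))
  from theI'[OF this] show "\<gamma> \<in> hom C I (omap B I)"
    and "\<gamma> \<cdot> i = amap B (alg_hat C \<Sigma> S I i) \<cdot> \<rho> I \<cdot> amap \<Sigma> (pairing C P (Ident C I) \<gamma>)"
    unfolding \<gamma>_def operational_model_def by auto
qed

section \<open>Lifting coalgebras to free algebras\<close>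

abbreviation free_mult :: "'o \<Rightarrow> 'm" where
  "free_mult X \<equiv> alg_hat C \<Sigma> S (star_obj S X) (star_alg S X)"

text \<open>Here d plays the role of the lifted coalgebra of c from the overview. It is encoded as a
  relation, so that the following lemmas work directly with the two recursion equations.\<close>

definition is_lift :: "'o \<Rightarrow> 'm \<Rightarrow> 'm \<Rightarrow> bool" where
  "is_lift X c d \<longleftrightarrow> d \<in> hom C (star_obj S X) (omap B (star_obj S X)) \<and>
     d \<cdot> star_unit S X = amap B (star_unit S X) \<cdot> c \<and>
     d \<cdot> star_alg S X =
       amap B (free_mult X) \<cdot> \<rho> (star_obj S X) \<cdot> amap \<Sigma> (pairing C P (Ident C (star_obj S X)) d)"

lemma is_lift_exists:
  assumes "coalgebra C B X c"
  obtains d where "is_lift X c d"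
proof -
  have t: "X \<in> Obj C" "c \<in> Arr C" "Dom C c = X" "Cod C c = omap B X"
    using assms by (auto simp: coalgebra_def hom_def)
  note A = algebra_star[OF t(1)]
  let ?T = "star_obj S X" and ?g = "amap B (free_mult X) \<cdot> \<rho> (star_obj S X)"
  have BT: "omap B ?T \<in> Obj C"
    using t by (simp add: all_simps)
  have g: "?g \<in> hom C (omap \<Sigma> (prod_obj P ?T (omap B ?T))) (omap B ?T)"
    using t A by (simp add: hom_def all_simps alg_hat_simps)
  have z: "amap B (star_unit S X) \<cdot> c \<in> hom C X (omap B ?T)"
    using t by (simp add: hom_def all_simps)
  obtain d where d: "d \<in> hom C ?T (omap B ?T)" "d \<cdot> star_unit S X = amap B (star_unit S X) \<cdot> c"
    "d \<cdot> star_alg S X = ?g \<cdot> amap \<Sigma> (pairing C P (Ident C ?T) d)"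
    using primitive_recursion_free_exists[OF t(1) BT g z] by blast
  moreover have "?g \<cdot> amap \<Sigma> (pairing C P (Ident C ?T) d) =
      amap B (free_mult X) \<cdot> \<rho> ?T \<cdot> amap \<Sigma> (pairing C P (Ident C ?T) d)"
    using d(1) t A by (simp add: hom_def all_simps alg_hat_simps)
  ultimately show thesis
    using that by (simp add: is_lift_def)
qed

text \<open>Pushing a lift forward along h yields a solution of the recursion over A, so uniqueness
  can compare it with other solutions. Naturality of \<open>\<rho>\<close> enters the development
  only here.\<close>

lemma lift_step:
  assumes X: "X \<in> Obj C" and d: "is_lift X c d" and A: "algebra C \<Sigma> A a"
    and h: "algebra_hom C \<Sigma> (star_obj S X) (star_alg S X) A a h"
    and nat: "natural_wrt C P \<Sigma> S B \<rho> h"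
  shows "(amap B h \<cdot> d) \<cdot> star_alg S X =
    (amap B (alg_hat C \<Sigma> S A a) \<cdot> \<rho> A) \<cdot> amap \<Sigma> (pairing C P h (amap B h \<cdot> d))"
proof -
  let ?T = "star_obj S X" and ?p = "pairing C P (Ident C (star_obj S X)) d"
  have t: "h \<in> Arr C" "Dom C h = ?T" "Cod C h = A" "d \<in> Arr C" "Dom C d = ?T"
    "Cod C d = omap B ?T" "A \<in> Obj C"
    using d h A by (auto simp: is_lift_def algebra_hom_def hom_def algebra_def)
  note s = all_simps alg_hat_simps[OF A] alg_hat_simps[OF algebra_star[OF X]] star_map_simps
  have "(amap B h \<cdot> d) \<cdot> star_alg S X = amap B h \<cdot> amap B (free_mult X) \<cdot> \<rho> ?T \<cdot> amap \<Sigma> ?p"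
    using d t X by (simp add: is_lift_def s)
  also have "\<dots> = amap B (h \<cdot> free_mult X) \<cdot> \<rho> ?T \<cdot> amap \<Sigma> ?p"
    using t X by (simp add: s)
  \<comment> \<open>As h is an algebra morphism out of a free algebra, h after the multiplication
    equals evaluation in A after \<open>star_map C \<Sigma> S h\<close>. This produces the factor
    that naturality needs.\<close>
  also have "\<dots> = amap B (alg_hat C \<Sigma> S A a \<cdot> star_map C \<Sigma> S h) \<cdot> \<rho> ?T \<cdot> amap \<Sigma> ?p"
    by (simp only: algebra_hom_alg_hat_natural[OF algebra_star[OF X] A h])
  also have "\<dots> = amap B (alg_hat C \<Sigma> S A a) \<cdot> (amap B (star_map C \<Sigma> S h) \<cdot> \<rho> ?T) \<cdot> amap \<Sigma> ?p"
    using t X by (simp add: s)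
  also have "amap B (star_map C \<Sigma> S h) \<cdot> \<rho> ?T = \<rho> A \<cdot> amap \<Sigma> (prod_map C P h (amap B h))"
    using nat t by (simp add: natural_wrt_def)
  also have "amap B (alg_hat C \<Sigma> S A a) \<cdot> (\<rho> A \<cdot> amap \<Sigma> (prod_map C P h (amap B h))) \<cdot> amap \<Sigma> ?p =
      (amap B (alg_hat C \<Sigma> S A a) \<cdot> \<rho> A) \<cdot> amap \<Sigma> (prod_map C P h (amap B h) \<cdot> ?p)"
    using t X by (simp add: s)
  \<comment> \<open>The product map absorbs the pairing, and its first component becomes h after the
    identity.\<close>
  also have "prod_map C P h (amap B h) \<cdot> ?p = pairing C P h (amap B h \<cdot> d)"
    using t X by (subst prod_map_pairing) (simp_all add: s)
  finally show ?thesis .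
qed

text \<open>Both composites solve the same recursion along the evaluation map and give the
  operational model on generators. For the model after evaluation, the recursion comes from its
  defining equation; for the pushed-forward lift it comes from \<open>lift_step\<close>.\<close>

lemma coalgebra_hom_alg_hat:
  assumes init: "initial_algebra C \<Sigma> I i"
    and nat: "natural_wrt C P \<Sigma> S B \<rho> (alg_hat C \<Sigma> S I i)"
    and d: "is_lift I (operational_model C P \<Sigma> S B \<rho> I i) d"
  shows "coalgebra_hom C B (star_obj S I) d I (operational_model C P \<Sigma> S B \<rho> I i)
    (alg_hat C \<Sigma> S I i)"
proof -
  let ?\<gamma> = "operational_model C P \<Sigma> S B \<rho> I i" and ?h = "alg_hat C \<Sigma> S I i" and ?T = "star_obj S I"
  let ?g = "amap B ?h \<cdot> \<rho> I"
  have A: "algebra C \<Sigma> I i" and I: "I \<in> Obj C" and i: "i \<in> Arr C" "Dom C i = omap \<Sigma> I" "Cod C i = I"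
    using init by (auto simp: initial_algebra_def algebra_def hom_def)
  note op = operational_model[OF init]
  have t: "?\<gamma> \<in> Arr C" "Dom C ?\<gamma> = I" "Cod C ?\<gamma> = omap B I"
    "d \<in> Arr C" "Dom C d = ?T" "Cod C d = omap B ?T"
    using op(1) d by (auto simp: hom_def is_lift_def)
  note s = all_simps alg_hat_simps[OF A]
  have "?\<gamma> \<cdot> ?h = amap B ?h \<cdot> d"
  proof (rule primitive_recursion_free_unique[OF I A _ _ alg_hat(1)[OF A]])
    show "omap B I \<in> Obj C" using I by (simp add: s)
    show "?g \<in> hom C (omap \<Sigma> (prod_obj P I (omap B I))) (omap B I)"
      using I by (simp add: hom_def s)
    show "?\<gamma> \<cdot> ?h \<in> hom C ?T (omap B I)" "amap B ?h \<cdot> d \<in> hom C ?T (omap B I)"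
      using t I by (simp_all add: hom_def s)
    have "(amap B ?h \<cdot> d) \<cdot> star_unit S I = amap B (?h \<cdot> star_unit S I) \<cdot> ?\<gamma>"
      using d t I by (simp add: is_lift_def s)
    then show "(?\<gamma> \<cdot> ?h) \<cdot> star_unit S I = (amap B ?h \<cdot> d) \<cdot> star_unit S I"
      using t I by (simp add: s alg_hat(2)[OF A])
    have "(?\<gamma> \<cdot> ?h) \<cdot> star_alg S I = (?\<gamma> \<cdot> i) \<cdot> amap \<Sigma> ?h"
      using alg_hat(1)[OF A] t I i by (simp add: algebra_hom_def s)
    also have "\<dots> = ?g \<cdot> amap \<Sigma> (pairing C P (Ident C I) ?\<gamma> \<cdot> ?h)"
      unfolding op(2) using t I by (simp add: s)
    also have "pairing C P (Ident C I) ?\<gamma> \<cdot> ?h = pairing C P ?h (?\<gamma> \<cdot> ?h)"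
      using t I by (simp add: s pairing_Comp)
    finally show "(?\<gamma> \<cdot> ?h) \<cdot> star_alg S I = ?g \<cdot> amap \<Sigma> (pairing C P ?h (?\<gamma> \<cdot> ?h))" .
    show "(amap B ?h \<cdot> d) \<cdot> star_alg S I = ?g \<cdot> amap \<Sigma> (pairing C P ?h (amap B ?h \<cdot> d))"
      by (rule lift_step[OF I d A alg_hat(1)[OF A] nat])
  qed
  then show ?thesis
    using I by (simp add: coalgebra_hom_def hom_def s)
qed

text \<open>Again two solutions of one recursion, now along \<open>star_map C \<Sigma> S f\<close>
  into the free algebra on Y. They agree on generators because f is a coalgebra morphism.\<close>

lemma coalgebra_hom_star_map:
  assumes X: "coalgebra C B X c" and Y: "coalgebra C B Y c'" and f: "coalgebra_hom C B X c Y c' f"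
    and d: "is_lift X c d" and d': "is_lift Y c' d'"
    and nat: "natural_wrt C P \<Sigma> S B \<rho> (star_map C \<Sigma> S f)"
  shows "coalgebra_hom C B (star_obj S X) d (star_obj S Y) d' (star_map C \<Sigma> S f)"
proof -
  let ?h = "star_map C \<Sigma> S f" and ?T = "star_obj S X" and ?U = "star_obj S Y"
  let ?g = "amap B (free_mult Y) \<cdot> \<rho> ?U"
  have t: "X \<in> Obj C" "Y \<in> Obj C" "c \<in> Arr C" "Dom C c = X" "Cod C c = omap B X"
    "c' \<in> Arr C" "Dom C c' = Y" "Cod C c' = omap B Y" "f \<in> Arr C" "Dom C f = X" "Cod C f = Y"
    "d \<in> Arr C" "Dom C d = ?T" "Cod C d = omap B ?T"
    "d' \<in> Arr C" "Dom C d' = ?U" "Cod C d' = omap B ?U"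
    and fc: "c' \<cdot> f = amap B f \<cdot> c"
    using X Y f d d' by (auto simp: coalgebra_def coalgebra_hom_def hom_def is_lift_def)
  note A = algebra_star[OF t(2)]
  note h = star_map[OF t(9-11)]
  note s = all_simps alg_hat_simps[OF A] star_map_simps
  have "d' \<cdot> ?h = amap B ?h \<cdot> d"
  proof (rule primitive_recursion_free_unique[OF t(1) A _ _ h(1)])
    show "omap B ?U \<in> Obj C" using t by (simp add: s)
    show "?g \<in> hom C (omap \<Sigma> (prod_obj P ?U (omap B ?U))) (omap B ?U)"
      using t by (simp add: hom_def s)
    show "d' \<cdot> ?h \<in> hom C ?T (omap B ?U)" "amap B ?h \<cdot> d \<in> hom C ?T (omap B ?U)"
      using t by (simp_all add: hom_def s)
    have "(d' \<cdot> ?h) \<cdot> star_unit S X = (d' \<cdot> star_unit S Y) \<cdot> f"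
      using t by (simp add: s h(2))
    also have "\<dots> = amap B (star_unit S Y) \<cdot> c' \<cdot> f"
      using d' t by (simp add: is_lift_def s)
    also have "\<dots> = amap B (star_unit S Y \<cdot> f) \<cdot> c"
      unfolding fc using t by (simp add: s)
    also have "\<dots> = amap B (?h \<cdot> star_unit S X) \<cdot> c"
      by (simp only: h(2))
    also have "\<dots> = (amap B ?h \<cdot> d) \<cdot> star_unit S X"
      using d t by (simp add: is_lift_def s)
    finally show "(d' \<cdot> ?h) \<cdot> star_unit S X = (amap B ?h \<cdot> d) \<cdot> star_unit S X" .
    have "(d' \<cdot> ?h) \<cdot> star_alg S X = (d' \<cdot> star_alg S Y) \<cdot> amap \<Sigma> ?h"
      using h(1) t by (simp add: algebra_hom_def s)
    also have "\<dots> = (amap B (free_mult Y) \<cdot> \<rho> ?U \<cdot> amap \<Sigma> (pairing C P (Ident C ?U) d')) \<cdot> amap \<Sigma> ?h"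
      using d' by (simp add: is_lift_def)
    also have "\<dots> = ?g \<cdot> amap \<Sigma> (pairing C P (Ident C ?U) d' \<cdot> ?h)"
      using t by (simp add: s)
    also have "pairing C P (Ident C ?U) d' \<cdot> ?h = pairing C P ?h (d' \<cdot> ?h)"
      using t by (simp add: s pairing_Comp)
    finally show "(d' \<cdot> ?h) \<cdot> star_alg S X = ?g \<cdot> amap \<Sigma> (pairing C P ?h (d' \<cdot> ?h))" .
    show "(amap B ?h \<cdot> d) \<cdot> star_alg S X = ?g \<cdot> amap \<Sigma> (pairing C P ?h (amap B ?h \<cdot> d))"
      by (rule lift_step[OF t(1) d A h(1) nat])
  qed
  then show ?thesis
    using t by (simp add: coalgebra_hom_def hom_def s)
qed

section \<open>The algebra structure on the final coalgebra\<close>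

lemma coalgebra_hom_Comp:
  assumes "coalgebra C B A1 c1" "coalgebra C B A2 c2" "coalgebra C B A3 c3"
    and "coalgebra_hom C B A1 c1 A2 c2 f" "coalgebra_hom C B A2 c2 A3 c3 g"
  shows "coalgebra_hom C B A1 c1 A3 c3 (g \<cdot> f)"
proof -
  have t: "f \<in> Arr C" "Dom C f = A1" "Cod C f = A2" "g \<in> Arr C" "Dom C g = A2" "Cod C g = A3"
    "c1 \<in> Arr C" "Dom C c1 = A1" "Cod C c1 = omap B A1" "c2 \<in> Arr C" "Dom C c2 = A2"
    "Cod C c2 = omap B A2" "c3 \<in> Arr C" "Dom C c3 = A3" "Cod C c3 = omap B A3"
    and f: "c2 \<cdot> f = amap B f \<cdot> c1" and g: "c3 \<cdot> g = amap B g \<cdot> c2"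
    using assms by (auto simp: coalgebra_def coalgebra_hom_def hom_def)
  have "c3 \<cdot> g \<cdot> f = (c3 \<cdot> g) \<cdot> f"
    using t by (simp add: all_simps)
  also have "\<dots> = amap B g \<cdot> c2 \<cdot> f"
    unfolding g using t by (simp add: all_simps)
  also have "\<dots> = amap B (g \<cdot> f) \<cdot> c1"
    unfolding f using t by (simp add: all_simps)
  finally show ?thesis
    using t by (simp add: coalgebra_hom_def hom_def all_simps)
qed

lemma beh_morphic_congruence:
  assumes init: "initial_algebra C \<Sigma> I i" and final: "final_coalgebra C B N t"
    and nat_hat: "natural_wrt C P \<Sigma> S B \<rho> (alg_hat C \<Sigma> S I i)"
    and nat_beh: "natural_wrt C P \<Sigma> S B \<rho> (star_map C \<Sigma> S (beh C P \<Sigma> S B \<rho> I i N t))"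
  shows "morphic_congruence C \<Sigma> I i N (beh C P \<Sigma> S B \<rho> I i N t)"
proof -
  let ?\<gamma> = "operational_model C P \<Sigma> S B \<rho> I i" and ?b = "beh C P \<Sigma> S B \<rho> I i N t"
  let ?h = "alg_hat C \<Sigma> S I i" and ?sb = "star_map C \<Sigma> S (beh C P \<Sigma> S B \<rho> I i N t)"
  have A: "algebra C \<Sigma> I i" and I: "I \<in> Obj C"
    and i: "i \<in> Arr C" "Dom C i = omap \<Sigma> I" "Cod C i = I"
    using init by (auto simp: initial_algebra_def algebra_def hom_def)
  have N: "coalgebra C B N t" and NO: "N \<in> Obj C"
    and ex1: "\<And>A c. coalgebra C B A c \<Longrightarrow> \<exists>!h. coalgebra_hom C B A c N t h"
    using final by (auto simp: final_coalgebra_def coalgebra_def)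
  have G: "coalgebra C B I ?\<gamma>"
    using operational_model(1)[OF init] I by (simp add: coalgebra_def)
  have b: "coalgebra_hom C B I ?\<gamma> N t ?b"
    unfolding beh_def coalg_unfold_def by (rule theI'[OF ex1[OF G]])
  then have tb: "?b \<in> Arr C" "Dom C ?b = I" "Cod C ?b = N"
    by (auto simp: coalgebra_hom_def hom_def)
  obtain d where d: "is_lift I ?\<gamma> d" using is_lift_exists[OF G] .
  obtain e where e: "is_lift N t e" using is_lift_exists[OF N] .
  have D: "coalgebra C B (star_obj S I) d"
    using d I by (simp add: coalgebra_def is_lift_def star_simps)
  have E: "coalgebra C B (star_obj S N) e"
    using e NO by (simp add: coalgebra_def is_lift_def star_simps)
  obtain \<beta> where \<beta>: "coalgebra_hom C B (star_obj S N) e N t \<beta>"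
    using ex1[OF E] by blast
  then have t\<beta>: "\<beta> \<in> Arr C" "Dom C \<beta> = star_obj S N" "Cod C \<beta> = N"
    by (auto simp: coalgebra_hom_def hom_def)
  note sb = star_map[OF tb] and h = alg_hat[OF A]
  \<comment> \<open>Both sides are coalgebra morphisms from the lift of the operational model to the
    final coalgebra.\<close>
  have eq: "\<beta> \<cdot> ?sb = ?b \<cdot> ?h"
    using ex1[OF D]
      coalgebra_hom_Comp[OF D E N coalgebra_hom_star_map[OF G N b d e nat_beh] \<beta>]
      coalgebra_hom_Comp[OF D G N coalgebra_hom_alg_hat[OF init nat_hat d] b]
    by blast
  note s = all_simps alg_hat_simps[OF A] star_map_simps
  \<comment> \<open>The operation on behaviours: regard the arguments as variables, form the
    one-layer term over them, and take the behaviour of that term under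
    \<open>\<beta>\<close>.\<close>
  let ?a = "\<beta> \<cdot> star_alg S N \<cdot> amap \<Sigma> (star_unit S N)"
  have "?a \<cdot> amap \<Sigma> ?b = \<beta> \<cdot> star_alg S N \<cdot> amap \<Sigma> (star_unit S N \<cdot> ?b)"
    using tb t\<beta> NO by (simp add: s)
  \<comment> \<open>Naturality of the unit trades substituting behaviours as variables for applying
    \<open>?sb\<close> to terms, which can then be carried past \<open>star_alg\<close> to meet
    \<open>\<beta>\<close>.\<close>
  also have "\<dots> = \<beta> \<cdot> (star_alg S N \<cdot> amap \<Sigma> ?sb) \<cdot> amap \<Sigma> (star_unit S I)"
    unfolding sb(2)[symmetric] using tb t\<beta> NO I by (simp add: s)
  also have "star_alg S N \<cdot> amap \<Sigma> ?sb = ?sb \<cdot> star_alg S I"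
    using sb(1) by (simp add: algebra_hom_def)
  also have "\<beta> \<cdot> (?sb \<cdot> star_alg S I) \<cdot> amap \<Sigma> (star_unit S I) =
      (\<beta> \<cdot> ?sb) \<cdot> star_alg S I \<cdot> amap \<Sigma> (star_unit S I)"
    using tb t\<beta> NO I by (simp add: s)
  also have "\<dots> = ?b \<cdot> (?h \<cdot> star_alg S I) \<cdot> amap \<Sigma> (star_unit S I)"
    unfolding eq using tb I by (simp add: s)
  also have "?h \<cdot> star_alg S I = i \<cdot> amap \<Sigma> ?h"
    using h(1) by (simp add: algebra_hom_def)
  also have "?b \<cdot> (i \<cdot> amap \<Sigma> ?h) \<cdot> amap \<Sigma> (star_unit S I) = ?b \<cdot> i \<cdot> amap \<Sigma> (?h \<cdot> star_unit S I)"
    using tb I i by (simp add: s)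
  \<comment> \<open>Evaluating a generator returns it, so the composite under
    \<open>amap \<Sigma>\<close> is the identity.\<close>
  also have "\<dots> = ?b \<cdot> i"
    using i I by (simp add: h(2) s)
  finally have "?b \<cdot> i = ?a \<cdot> amap \<Sigma> ?b" ..
  moreover have "algebra C \<Sigma> N ?a"
    using t\<beta> NO by (simp add: algebra_def hom_def s)
  moreover have "?b \<in> hom C I N"
    using tb by (simp add: hom_def)
  ultimately show ?thesis
    using A unfolding morphic_congruence_def by blast
qed

end

theorem theorem12:
  fixes C :: "('o, 'm) category"
    and P :: "('o, 'm) binprod"
    and \<Sigma> B :: "('o, 'm) endo"
    and S :: "('o, 'm) free_algs"
    and \<mu>\<Sigma> \<nu>B :: 'o
    and \<iota> \<tau> :: 'm
    and \<rho> :: "'o \<Rightarrow> 'm"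
  assumes "category C"
    and "binary_products C P"
    and "endofunctor C \<Sigma>"
    and "initial_algebra C \<Sigma> \<mu>\<Sigma> \<iota>"
    and "free_algebras C \<Sigma> S"
    and "endofunctor C B"
    and "final_coalgebra C B \<nu>B \<tau>"
    and "pre_GSOS_law C P \<Sigma> S B \<rho>"
    and "natural_wrt C P \<Sigma> S B \<rho> (alg_hat C \<Sigma> S \<mu>\<Sigma> \<iota>)"
    and "natural_wrt C P \<Sigma> S B \<rho> (star_map C \<Sigma> S (beh C P \<Sigma> S B \<rho> \<mu>\<Sigma> \<iota> \<nu>B \<tau>))"
  shows "morphic_congruence C \<Sigma> \<mu>\<Sigma> \<iota> \<nu>B (beh C P \<Sigma> S B \<rho> \<mu>\<Sigma> \<iota> \<nu>B \<tau>)"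
proof -
  interpret pre_GSOS C P \<Sigma> B S \<rho>
    using assms by (intro pre_GSOS.intro pre_GSOS_axioms.intro)
  show ?thesis
    using assms by (intro beh_morphic_congruence)
qed

end
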